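(* Let $G$ be a finite directed graph with a global sink, with a fixed cyclic ordering of the outgoing edges at each non-sink vertex, and let $\rho$ be an acyclic rotor configuration on $G$. If the chip configurations $\sigma_1$ and $\sigma_2$ on $G$ are equivalent modulo the reduced Laplacian $\Delta'$ of $G$, then $\sigma_1(\rho)=\sigma_2(\rho)$.
   Context: Directed graphs are finite; self-loops and multiple edges are allowed. A sink is a vertex of out-degree zero; a global sink is a sink $s$ such that from every other vertex there is a directed path leading to $s$. Let $d_v$ be the out-degree of $v$ and $a_{vw}$ the number of edges from $v$ to $w$. The reduced Laplacian $\Delta'$ is the integer matrix indexed by the non-sink vertices with $\Delta'_{vw}=-a_{vw}$ for $v\ne w$ and $\Delta'_{vv}=d_v-a_{vv}$. If $G$ has $n$ vertices, two vectors in $\mathbb{Z}^{n-1}$ (indexed by non-sink vertices) are equivalent modulo $\Delta'$ if their difference lies in the integer row span $\mathbb{Z}^{n-1}\Delta'$. A chip configuration is a vector $\sigma$ of non-negative integers indexed by the non-sink vertices. For each non-sink vertex $v$ a cyclic ordering of the edges emanating from $v$ is fixed, and $e^+$ denotes the edge following $e$ in it. A rotor configuration is a function $\rho$ assigning to each non-sink vertex $v$ an edge $\rho(v)$ emanating from $v$. It is acyclic if the edges $\rho(v)$ do not form any directed cycle. Routing a chip at a non-sink vertex $v$ for one step means replacing $\rho(v)$ by $\rho(v)^+$ and then moving the chip to the head of $\rho(v)^+$. For a non-sink vertex $v$, the chip addition operator $E_v$ is the map on rotor configurations given by adding a chip at $v$ and routing it repeatedly until it reaches the sink (which always happens after finitely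 many steps). The operators $E_v$ commute. For a chip configuration $\sigma$ and a rotor configuration $\rho$, $\sigma(\rho)=\left(\prod_{v\neq s}E_v^{\sigma(v)}\right)\rho$ (composition of operators), i.e. the rotor configuration obtained by adding $\sigma(v)$ chips at each vertex $v$ and routing them all to the sink. *)

theory Defs
  imports
    "Graph_Theory.Digraph"
    "Graph_Theory.Arc_Walk"
    "HOL-Combinatorics.Orbits"
    "HOL-Library.While_Combinator"
begin

definition sink :: "('a, 'b) pre_digraph \<Rightarrow> 'a \<Rightarrow> bool" where
  "sink G v \<longleftrightarrow> v \<in> verts G \<and> out_degree G v = 0"

definition global_sink :: "('a, 'b) pre_digraph \<Rightarrow> 'a \<Rightarrow> bool" where
  "global_sink G s \<longleftrightarrow> sink G s \<and> (\<forall>v \<in> verts G - {s}. v \<rightarrow>\<^sup>*\<^bsub>G\<^esub> s)"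

definition nonsinks :: "('a, 'b) pre_digraph \<Rightarrow> 'a set" where
  "nonsinks G = {v \<in> verts G. \<not> sink G v}"

definition edge_count :: "('a, 'b) pre_digraph \<Rightarrow> 'a \<Rightarrow> 'a \<Rightarrow> nat" where
  "edge_count G v w = card {e \<in> out_arcs G v. head G e = w}"

(* Self-loops at v are subtracted on the diagonal.  Only entries with both indices in
   nonsinks G are meaningful. *)
definition reduced_laplacian :: "('a, 'b) pre_digraph \<Rightarrow> 'a \<Rightarrow> 'a \<Rightarrow> int" where
  "reduced_laplacian G v w =
     (if v = w then int (out_degree G v) - int (edge_count G v v)
      else - int (edge_count G v w))"

(* Integer vectors indexed by the non-sink vertices are total functions whose values
   outside nonsinks G are ignored; c is the coefficient vector of a row combination. *)
definition laplacian_equiv ::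
    "('a, 'b) pre_digraph \<Rightarrow> ('a \<Rightarrow> int) \<Rightarrow> ('a \<Rightarrow> int) \<Rightarrow> bool" where
  "laplacian_equiv G x y \<longleftrightarrow>
     (\<exists>c :: 'a \<Rightarrow> int. \<forall>w \<in> nonsinks G.
        x w - y w = (\<Sum>v \<in> nonsinks G. c v * reduced_laplacian G v w))"

(* nxt e is the edge following e: on the edges leaving a non-sink vertex, nxt is a
   permutation with a single cycle. *)
definition rotor_order :: "('a, 'b) pre_digraph \<Rightarrow> ('b \<Rightarrow> 'b) \<Rightarrow> bool" where
  "rotor_order G nxt \<longleftrightarrow> (\<forall>v \<in> nonsinks G. cyclic_on nxt (out_arcs G v))"

(* Extensional functions, so that equality in HOL is equality on the non-sink vertices. *)
definition rotor_configs :: "('a, 'b) pre_digraph \<Rightarrow> ('a \<Rightarrow> 'b) set" where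
  "rotor_configs G = (\<Pi>\<^sub>E v \<in> nonsinks G. out_arcs G v)"

(* Self-loops count as directed cycles. *)
definition acyclic_rotor :: "('a, 'b) pre_digraph \<Rightarrow> ('a \<Rightarrow> 'b) \<Rightarrow> bool" where
  "acyclic_rotor G \<rho> \<longleftrightarrow>
     \<not> (\<exists>p. pre_digraph.cycle G p \<and> set p \<subseteq> \<rho> ` nonsinks G)"

(* The state is the position of the chip together with the rotor configuration. *)
definition route_step ::
    "('a, 'b) pre_digraph \<Rightarrow> ('b \<Rightarrow> 'b) \<Rightarrow> 'a \<times> ('a \<Rightarrow> 'b) \<Rightarrow> 'a \<times> ('a \<Rightarrow> 'b)" where
  "route_step G nxt = (\<lambda>(w, \<rho>). (head G (nxt (\<rho> w)), \<rho>(w := nxt (\<rho> w))))"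

(* With a global sink and rotors in rotor_configs G the loop terminates; the sink it stops
   at is then the only one. *)
definition chip_add ::
    "('a, 'b) pre_digraph \<Rightarrow> ('b \<Rightarrow> 'b) \<Rightarrow> 'a \<Rightarrow> ('a \<Rightarrow> 'b) \<Rightarrow> ('a \<Rightarrow> 'b)" where
  "chip_add G nxt v \<rho> =
     snd (while (\<lambda>(w, _). \<not> sink G w) (route_step G nxt) (v, \<rho>))"

(* The composition of the operators chip_add G nxt v ^^ \<sigma> v over all non-sink v.  The order
   of composition is immaterial because these operators commute on rotor_configs G. *)
definition chip_act ::
    "('a, 'b) pre_digraph \<Rightarrow> ('b \<Rightarrow> 'b) \<Rightarrow> ('a \<Rightarrow> nat) \<Rightarrow> ('a \<Rightarrow> 'b) \<Rightarrow> ('a \<Rightarrow> 'b)" where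
  "chip_act G nxt \<sigma> \<rho> =
     Finite_Set.fold (\<lambda>v. chip_add G nxt v ^^ \<sigma> v) \<rho> (nonsinks G)"

end

theory Submission
  imports Defs "HOL-Library.Confluence" "HOL-Library.Multiset"
begin

text \<open>
  Moving one of several chips at a time is a strongly confluent relation, so the rotors left when
  all chips have reached the sink depend only on the chip configuration and the initial rotors.
  Firing a vertex as often as its out-degree restores its rotor and sends one chip along every
  outgoing edge. Write \<open>\<sigma>\<^sub>1 - \<sigma>\<^sub>2 = c \<Delta>'\<close> and split \<open>c\<close> into positive and negative part: adding
  the same chips \<open>\<tau>\<close> to both sides then gives \<open>\<tau>(\<sigma>\<^sub>1(\<rho>)) = \<tau>(\<sigma>\<^sub>2(\<rho>))\<close>, and \<open>\<tau>\<close> can be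
  cancelled because chip addition preserves acyclicity and is injective on acyclic configurations.
  For the injectivity, add an edge from the sink to the start \<open>v\<close> of the chip: throughout its route,
  following rotors from any vertex leads to the chip. Hence the previous position of the chip lies
  on the unique rotor cycle through its current position, and the route can be run backwards.
\<close>

section \<open>Orbits of a self-map that reach a given point\<close>

definition orbit_hits :: "('c \<Rightarrow> 'c) \<Rightarrow> 'c \<Rightarrow> 'c \<Rightarrow> bool" where
  "orbit_hits f w u \<longleftrightarrow> (\<exists>n. (f ^^ n) u = w)"

text \<open>Up to its first visit to \<open>w\<close> the orbit of \<open>u\<close> never evaluates
  \<open>f\<close> at \<open>w\<close>, so the value there may be changed freely.\<close>

lemma orbit_hits_upd:
  assumes "orbit_hits f w u"
  shows "orbit_hits (f(w := x)) w u"
proof -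
  have "(f ^^ n) u = w \<Longrightarrow> orbit_hits (f(w := x)) w u" for n
  proof (induction n arbitrary: u)
    case 0
    then show ?case by (auto simp: orbit_hits_def intro: exI[of _ 0])
  next
    case (Suc n)
    show ?case
    proof (cases "u = w")
      case True
      then show ?thesis by (auto simp: orbit_hits_def intro: exI[of _ 0])
    next
      case False
      have "(f ^^ n) (f u) = w" using Suc.prems by (simp add: funpow_swap1)
      then obtain m where "((f(w := x)) ^^ m) (f u) = w"
        using Suc.IH[of "f u"] unfolding orbit_hits_def by blast
      then have "((f(w := x)) ^^ Suc m) u = w" using False by (simp add: funpow_swap1)
      then show ?thesis unfolding orbit_hits_def by blast
    qed
  qed
  then show ?thesis using assms by (auto simp: orbit_hits_def)
qed

lemma orbit_hits_image: "orbit_hits f w u \<Longrightarrow> orbit_hits f (f w) u"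
  unfolding orbit_hits_def by (metis funpow.simps(2) o_apply)

text \<open>Both preimages lie on the periodic orbit of \<open>x\<close>, one step before a return
  to \<open>x\<close>. One step before a common multiple of the two return times the orbit is at
  both of them.\<close>

lemma unique_periodic_preimage:
  assumes "orbit_hits f u x" "f u = x" "orbit_hits f u' x" "f u' = x"
  shows "u = u'"
proof -
  obtain a b where a: "(f ^^ a) x = u" and b: "(f ^^ b) x = u'"
    using assms by (auto simp: orbit_hits_def)
  have pa: "(f ^^ Suc a) x = x" and pb: "(f ^^ Suc b) x = x" using a b assms by auto
  \<comment> \<open>The exponent equals \<open>Suc a * Suc b - 1\<close>, which is symmetric in
    \<open>a\<close> and \<open>b\<close>: first \<open>b\<close> full returns of length
    \<open>Suc a\<close>, then \<open>a\<close> further steps to \<open>u\<close>.\<close>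
  have "(f ^^ (a + Suc a * b)) x = (f ^^ a) (((f ^^ Suc a) ^^ b) x)"
    by (simp only: funpow_add funpow_mult o_apply)
  also have "((f ^^ Suc a) ^^ b) x = x" using pa by (induction b) simp_all
  finally have u: "(f ^^ (a + Suc a * b)) x = u" using a by simp
  have "(f ^^ (b + Suc b * a)) x = (f ^^ b) (((f ^^ Suc b) ^^ a) x)"
    by (simp only: funpow_add funpow_mult o_apply)
  also have "((f ^^ Suc b) ^^ a) x = x" using pb by (induction a) simp_all
  finally have "(f ^^ (b + Suc b * a)) x = u'" using b by simp
  moreover have "b + Suc b * a = a + Suc a * b" by simp
  ultimately show ?thesis using u by metis
qed

section \<open>Routing a single chip and its termination\<close>

locale rotor_router = fin_digraph G for G :: "('a, 'b) pre_digraph" +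
  fixes s :: 'a and nxt :: "'b \<Rightarrow> 'b"
  assumes global_sink: "global_sink G s"
    and rotor_order: "rotor_order G nxt"
begin

abbreviation "step \<equiv> route_step G nxt"

text \<open>A vertex without outgoing edges reaches only itself, so it can reach the global sink
  only by being equal to it.\<close>

lemma sink_iff: "w \<in> verts G \<Longrightarrow> sink G w \<longleftrightarrow> w = s"
proof
  assume w: "w \<in> verts G" and "sink G w"
  then have none: "out_arcs G w = {}"
    using finite_out_arcs[of w] by (simp add: sink_def out_degree_def)
  show "w = s"
  proof (rule ccontr)
    assume "w \<noteq> s"
    then have "w \<rightarrow>\<^sup>*\<^bsub>G\<^esub> s" using global_sink w by (auto simp: global_sink_def)
    then show False using \<open>w \<noteq> s\<close> none
      by (cases rule: converse_reachable_cases) (auto simp: arcs_ends_def arc_to_ends_def out_arcs_def)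
  qed
qed (use global_sink in \<open>auto simp: global_sink_def\<close>)

lemma nonsinks_eq: "nonsinks G = verts G - {s}"
  using sink_iff by (auto simp: nonsinks_def)

lemma finite_nonsinks [simp]: "finite (nonsinks G)"
  by (simp add: nonsinks_eq)

lemma cyclic_nxt: "v \<in> nonsinks G \<Longrightarrow> cyclic_on nxt (out_arcs G v)"
  using rotor_order by (simp add: rotor_order_def)

lemma rotor_in_out_arcs: "\<rho> \<in> rotor_configs G \<Longrightarrow> v \<in> nonsinks G \<Longrightarrow> \<rho> v \<in> out_arcs G v"
  by (auto simp: rotor_configs_def)

lemma nxt_in_out_arcs: "v \<in> nonsinks G \<Longrightarrow> a \<in> out_arcs G v \<Longrightarrow> nxt a \<in> out_arcs G v"
  using cyclic_nxt cyclic_on_inI by metis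

text \<open>Every edge lies in its own orbit, which consists of proper iterates, so it has a
  predecessor. Hence \<open>nxt\<close> maps a finite set onto itself and is injective there by
  counting.\<close>

lemma inj_on_nxt: "v \<in> nonsinks G \<Longrightarrow> inj_on nxt (out_arcs G v)"
proof (rule eq_card_imp_inj_on)
  assume v: "v \<in> nonsinks G"
  have "nxt ` out_arcs G v = out_arcs G v"
  proof (intro subset_antisym subsetI)
    fix e assume e: "e \<in> out_arcs G v"
    then have "e \<in> orbit nxt e" using orbit_cyclic_eq3[OF cyclic_nxt[OF v]] by blast
    then show "e \<in> nxt ` out_arcs G v"
      by (cases rule: orbit.cases) (use e orbit_cyclic_eq3[OF cyclic_nxt[OF v]] in auto)
  qed (use nxt_in_out_arcs[OF v] in blast)
  then show "card (nxt ` out_arcs G v) = card (out_arcs G v)" by simp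
qed auto

lemma step_rotor_configs:
  assumes "\<rho> \<in> rotor_configs G" "w \<in> nonsinks G"
  shows "\<rho>(w := nxt (\<rho> w)) \<in> rotor_configs G"
  using assms nxt_in_out_arcs[OF assms(2) rotor_in_out_arcs[OF assms]]
  by (auto simp: rotor_configs_def PiE_iff extensional_def)

lemma step_in:
  assumes "fst x \<in> nonsinks G" "snd x \<in> rotor_configs G"
  shows "fst (step x) \<in> verts G" "snd (step x) \<in> rotor_configs G"
  using step_rotor_configs[OF assms(2,1)] nxt_in_out_arcs[OF assms(1) rotor_in_out_arcs[OF assms(2,1)]]
  by (auto simp: route_step_def split: prod.splits)

text \<open>A chip that never reached the sink would visit some vertex infinitely often. The rotor
  there runs through all outgoing edges again and again, so every out-neighbour is visited
  infinitely often as well; along a path to \<open>s\<close> this spreads to \<open>s\<close>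
  itself.\<close>

lemma route_reaches_sink:
  assumes v: "v \<in> nonsinks G" and \<rho>: "\<rho> \<in> rotor_configs G"
  shows "\<exists>n. fst ((step ^^ n) (v, \<rho>)) = s"
proof (rule ccontr)
  define X where "X n = (step ^^ n) (v, \<rho>)" for n
  have XS: "X (Suc n) = step (X n)" for n by (simp add: X_def)
  assume "\<not> ?thesis"
  then have no: "fst (X n) \<noteq> s" for n by (auto simp: X_def)
  have X: "fst (X n) \<in> nonsinks G \<and> snd (X n) \<in> rotor_configs G" for n
  proof (induction n)
    case 0
    then show ?case by (simp add: X_def v \<rho>)
  next
    case (Suc n)
    then show ?case using step_in[of "X n"] no[of "Suc n"] by (auto simp: XS nonsinks_eq)
  qed
  \<comment> \<open>The times at which the chip leaves \<open>u\<close> along the edge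
    \<open>a\<close>; the rotor advances before the chip moves.\<close>
  define T where "T u a = {n. fst (X n) = u \<and> nxt (snd (X n) u) = a}" for u a
  have next_arc: "infinite (T u (nxt a))" if inf: "infinite (T u a)" for u a
    unfolding infinite_nat_iff_unbounded
  proof
    fix m
    obtain n where n: "n > m" "n \<in> T u a" using inf unfolding infinite_nat_iff_unbounded by blast
    obtain n' where n': "n' > n" "n' \<in> T u a" using inf unfolding infinite_nat_iff_unbounded by blast
    \<comment> \<open>The first return to \<open>u\<close> after time \<open>n\<close>. The rotor at
      \<open>u\<close> still points along \<open>a\<close> then, so the chip leaves along
      \<open>nxt a\<close>.\<close>
    define k where "k = (LEAST k. k > n \<and> fst (X k) = u)"
    have k: "k > n \<and> fst (X k) = u"
      unfolding k_def by (rule LeastI[of _ n']) (use n' in \<open>simp add: T_def\<close>)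
    have least: "fst (X j) \<noteq> u" if "n < j" "j < k" for j
      using that not_less_Least unfolding k_def by blast
    have "n < j \<Longrightarrow> j \<le> k \<Longrightarrow> snd (X j) u = a" for j
    proof (induction j)
      case (Suc j)
      show ?case
      proof (cases "j = n")
        case True
        then show ?thesis using n by (simp add: XS T_def route_step_def case_prod_beta)
      next
        case False
        then have "snd (X j) u = a" "fst (X j) \<noteq> u" using Suc least by auto
        then show ?thesis by (auto simp: XS route_step_def split: prod.splits)
      qed
    qed simp
    then have "snd (X k) u = a" using k by blast
    then show "\<exists>n>m. n \<in> T u (nxt a)" using k n by (auto simp: T_def intro!: exI[of _ k])
  qed
  have succ: "infinite {n. fst (X n) = head G e}"
    if inf: "infinite {n. fst (X n) = u}" and e: "e \<in> out_arcs G u" for u e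
  proof -
    have u: "u \<in> nonsinks G" using inf X by (metis (mono_tags, lifting) Collect_empty_eq finite.emptyI)
    let ?f = "\<lambda>n. nxt (snd (X n) u)"
    have "?f ` {n. fst (X n) = u} \<subseteq> out_arcs G u"
      using X nxt_in_out_arcs[OF u rotor_in_out_arcs[OF _ u]] by blast
    then have "finite (?f ` {n. fst (X n) = u})" by (rule finite_subset) auto
    from pigeonhole_infinite[OF inf this] obtain n where n: "fst (X n) = u"
      and "infinite {m \<in> {n. fst (X n) = u}. ?f m = ?f n}" by blast
    then have Tn: "infinite (T u (?f n))" by (simp add: T_def)
    have "?f n \<in> out_arcs G u" using X nxt_in_out_arcs[OF u rotor_in_out_arcs[OF _ u]] by blast
    then have "e \<in> orbit nxt (?f n)" using e orbit_cyclic_eq3[OF cyclic_nxt[OF u]] by blast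
    then have "infinite (T u e)"
      by (induction rule: orbit.induct) (use Tn next_arc in blast)+
    moreover have "Suc ` T u e \<subseteq> {n. fst (X n) = head G e}"
      by (auto simp: T_def XS route_step_def split: prod.splits)
    ultimately show ?thesis
      using finite_imageD[of Suc "T u e"] finite_subset by auto
  qed
  have "finite ((fst \<circ> X) ` UNIV)"
    by (rule finite_subset[OF _ finite_nonsinks]) (use X in auto)
  from pigeonhole_infinite[OF infinite_UNIV_nat this]
  obtain n0 where n0: "infinite {n. fst (X n) = fst (X n0)}" by auto
  have "fst (X n0) \<rightarrow>\<^sup>*\<^bsub>G\<^esub> s"
    using global_sink X[of n0] by (auto simp: global_sink_def nonsinks_eq)
  then have "infinite {n. fst (X n) = s}"
  proof (induction rule: reachable_induct)
    case base
    show ?case by (rule n0)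
  next
    case (step x y)
    then obtain e where "e \<in> out_arcs G x" "head G e = y"
      by (auto simp: arcs_ends_def arc_to_ends_def)
    then show ?case using succ step.IH by blast
  qed
  then show False using no by simp
qed

text \<open>Replaces the while loop by a definite number of steps: \<open>n\<close> is the first
  time at \<open>s\<close>, which is also the least time at which the loop test fails.\<close>

lemma chip_add_route:
  assumes v: "v \<in> nonsinks G" and \<rho>: "\<rho> \<in> rotor_configs G"
  obtains n where "(step ^^ n) (v, \<rho>) = (s, chip_add G nxt v \<rho>)"
    and "\<And>k. k < n \<Longrightarrow> fst ((step ^^ k) (v, \<rho>)) \<in> nonsinks G"
    and "\<And>k. k \<le> n \<Longrightarrow> snd ((step ^^ k) (v, \<rho>)) \<in> rotor_configs G"
proof -
  define X where "X n = (step ^^ n) (v, \<rho>)" for n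
  define n where "n = (LEAST n. fst (X n) = s)"
  have ex: "\<exists>n. fst (X n) = s" using route_reaches_sink[OF assms] by (simp add: X_def)
  then have n: "fst (X n) = s" unfolding n_def by (rule LeastI_ex)
  have less: "fst (X k) \<noteq> s" if "k < n" for k using that not_less_Least unfolding n_def by blast
  have X: "k \<le> n \<Longrightarrow> fst (X k) \<in> verts G \<and> snd (X k) \<in> rotor_configs G" for k
  proof (induction k)
    case 0
    then show ?case using v \<rho> by (simp add: X_def nonsinks_eq)
  next
    case (Suc k)
    then show ?case using step_in[of "X k"] less[of k] by (simp add: X_def nonsinks_eq)
  qed
  have n_sink: "sink G (fst (X n))" using X[of n] n sink_iff by simp
  moreover have "\<not> sink G (fst (X k))" if "k < n" for k
    using that X[of k] less[of k] sink_iff[of "fst (X k)"] by simp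
  ultimately have "(LEAST k. sink G (fst (X k))) = n"
    by (intro Least_equality) (auto simp: not_less[symmetric])
  then have "chip_add G nxt v \<rho> = snd (X n)"
    unfolding chip_add_def while_def while_option_def
    using n_sink by (auto simp: X_def case_prod_beta)
  then have "X n = (s, chip_add G nxt v \<rho>)" using n by (simp add: prod_eq_iff)
  then show thesis using X less by (intro that[of n]) (auto simp: X_def nonsinks_eq)
qed

lemma chip_add_in:
  assumes "v \<in> nonsinks G" "\<rho> \<in> rotor_configs G"
  shows "chip_add G nxt v \<rho> \<in> rotor_configs G"
  using chip_add_route[OF assms] by (metis order_refl snd_conv)

lemma funpow_chip_add_in:
  assumes "v \<in> nonsinks G" "\<rho> \<in> rotor_configs G"
  shows "(chip_add G nxt v ^^ k) \<rho> \<in> rotor_configs G"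
  using assms by (induction k) (auto simp: chip_add_in)

section \<open>Moving many chips in any order\<close>

definition chip :: "'a \<Rightarrow> 'a multiset" where
  "chip w = (if w \<in> nonsinks G then {#w#} else {#})"

text \<open>A state consists of the positions of all chips still on non-sink vertices and of the
  rotors. A chip arriving at the sink disappears, since \<open>chip s\<close> is empty, so a
  finished state has the empty multiset.\<close>

inductive fire :: "'a multiset \<times> ('a \<Rightarrow> 'b) \<Rightarrow> 'a multiset \<times> ('a \<Rightarrow> 'b) \<Rightarrow> bool" where
  fireI: "v \<in> nonsinks G \<Longrightarrow>
    fire (add_mset v M, \<rho>) (M + chip (head G (nxt (\<rho> v))), \<rho>(v := nxt (\<rho> v)))"

abbreviation fires (infix "\<leadsto>" 50) where "x \<leadsto> y \<equiv> fire\<^sup>*\<^sup>* x y"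

text \<open>Moves at different vertices change different rotors and commute. Two moves at the same
  vertex have the same result, because chips are indistinguishable.\<close>

lemma confluentp_fire: "confluentp fire"
proof (rule strong_confluentp_imp_confluentp, rule strong_confluentpI)
  fix x y z assume "fire x y" "fire x z"
  then obtain v A w B \<rho> where v: "v \<in> nonsinks G" and w: "w \<in> nonsinks G"
    and eq: "add_mset v A = add_mset w B"
    and y: "y = (A + chip (head G (nxt (\<rho> v))), \<rho>(v := nxt (\<rho> v)))"
    and z: "z = (B + chip (head G (nxt (\<rho> w))), \<rho>(w := nxt (\<rho> w)))"
    by (elim fire.cases) auto
  show "\<exists>u. fire\<^sup>*\<^sup>* y u \<and> fire\<^sup>=\<^sup>= z u"
  proof (cases "v = w")
    case True
    then show ?thesis using eq y z by auto
  next
    case False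
    with eq obtain C where C: "A = add_mset w C" "B = add_mset v C"
      by (auto simp: add_eq_conv_ex)
    let ?u = "(C + chip (head G (nxt (\<rho> v))) + chip (head G (nxt (\<rho> w))),
      \<rho>(v := nxt (\<rho> v), w := nxt (\<rho> w)))"
    have "fire y ?u"
      using fireI[OF w, of "C + chip (head G (nxt (\<rho> v)))" "\<rho>(v := nxt (\<rho> v))"] False
      by (simp add: y C)
    moreover have "fire z ?u"
      using fireI[OF v, of "C + chip (head G (nxt (\<rho> w)))" "\<rho>(w := nxt (\<rho> w))"] False
      by (simp add: z C fun_upd_twist ac_simps)
    ultimately show ?thesis by blast
  qed
qed

lemma fires_final: "({#}, \<rho>) \<leadsto> x \<Longrightarrow> x = ({#}, \<rho>)"
  by (erule converse_rtranclpE) (auto elim: fire.cases)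

text \<open>A state without chips is terminal, so the common successor provided by confluence can
  only be that state.\<close>

lemma fires_confluent:
  assumes "x \<leadsto> y" "x \<leadsto> ({#}, \<rho>)"
  shows "y \<leadsto> ({#}, \<rho>)"
  using confluentpD[OF confluentp_fire assms] fires_final by blast

lemma fires_unique:
  assumes "x \<leadsto> ({#}, \<rho>)" "x \<leadsto> ({#}, \<rho>')"
  shows "\<rho> = \<rho>'"
  using fires_final[OF fires_confluent[OF assms(2,1)]] by simp

lemma fires_add:
  assumes "(M, \<rho>) \<leadsto> (M', \<rho>')"
  shows "(M + N, \<rho>) \<leadsto> (M' + N, \<rho>')"
  using assms
proof (induction "(M', \<rho>')" arbitrary: M' \<rho>' rule: rtranclp_induct)
  case (step y)
  obtain A \<rho>1 where y: "y = (A, \<rho>1)" by fastforce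
  from step(2) have "fire (A + N, \<rho>1) (M' + N, \<rho>')"
    unfolding y
  proof cases
    case (fireI v M)
    then show ?thesis using fire.fireI[of v "M + N" \<rho>1] by (simp add: ac_simps)
  qed
  then show ?case using step(3)[OF y] by simp
qed simp

lemma fires_add2:
  assumes "(M, \<rho>) \<leadsto> (M', \<rho>')" "(N, \<rho>') \<leadsto> (N', \<rho>'')"
  shows "(M + N, \<rho>) \<leadsto> (M' + N', \<rho>'')"
  using fires_add[OF assms(1), of N] fires_add[OF assms(2), of M'] by (simp add: add.commute)

text \<open>Each routing step of the chip is one firing, and the chip vanishes on arrival at
  \<open>s\<close>.\<close>

lemma fires_chip_add:
  assumes v: "v \<in> nonsinks G" and \<rho>: "\<rho> \<in> rotor_configs G"
  shows "({#v#}, \<rho>) \<leadsto> ({#}, chip_add G nxt v \<rho>)"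
proof -
  obtain n where n: "(step ^^ n) (v, \<rho>) = (s, chip_add G nxt v \<rho>)"
    and nonsink: "\<And>k. k < n \<Longrightarrow> fst ((step ^^ k) (v, \<rho>)) \<in> nonsinks G"
    using chip_add_route[OF assms] by metis
  have "k \<le> n \<Longrightarrow> ({#v#}, \<rho>) \<leadsto>
      (chip (fst ((step ^^ k) (v, \<rho>))), snd ((step ^^ k) (v, \<rho>)))" for k
  proof (induction k)
    case 0
    then show ?case using v by (simp add: chip_def)
  next
    case (Suc k)
    obtain w \<rho>' where eq: "(step ^^ k) (v, \<rho>) = (w, \<rho>')" by fastforce
    have w: "w \<in> nonsinks G" using nonsink[of k] Suc.prems eq by simp
    have "fire (chip w, \<rho>') (chip (head G (nxt (\<rho>' w))), \<rho>'(w := nxt (\<rho>' w)))"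
      using fireI[OF w, of "{#}" \<rho>'] w by (simp add: chip_def)
    then have "fire (chip w, \<rho>') (chip (fst (step (w, \<rho>'))), snd (step (w, \<rho>')))"
      by (simp add: route_step_def del: fun_upd_apply)
    then show ?case using Suc eq by auto
  qed
  from this[of n] show ?thesis by (simp add: n chip_def nonsinks_eq)
qed

lemma fires_funpow_chip_add:
  assumes "v \<in> nonsinks G" "\<rho> \<in> rotor_configs G"
  shows "(replicate_mset k v, \<rho>) \<leadsto> ({#}, (chip_add G nxt v ^^ k) \<rho>)"
proof (induction k)
  case (Suc k)
  from fires_add2[OF this fires_chip_add[OF assms(1) funpow_chip_add_in[OF assms]]]
  show ?case by simp
qed simp

text \<open>The fold adds the chips vertex by vertex, and each operator is realised by firings. The
  operators commute because both orders fire the same multiset and the final rotors are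
  unique.\<close>

lemma fires_chip_act:
  assumes \<rho>: "\<rho> \<in> rotor_configs G"
  shows "(\<Sum>v\<in>nonsinks G. replicate_mset (\<sigma> v) v, \<rho>) \<leadsto> ({#}, chip_act G nxt \<sigma> \<rho>)"
proof -
  let ?f = "\<lambda>v. chip_add G nxt v ^^ \<sigma> v"
  \<comment> \<open>The operators commute only on rotor configurations, whereas fold asks for commutation everywhere.\<close>
  define g where "g v \<rho> = (if \<rho> \<in> rotor_configs G then ?f v \<rho> else \<rho>)" for v \<rho>
  have g_in: "g v \<rho>' \<in> rotor_configs G" if "v \<in> nonsinks G" "\<rho>' \<in> rotor_configs G" for v \<rho>'
    using that by (simp add: g_def funpow_chip_add_in)
  have fires_g: "(replicate_mset (\<sigma> v) v, \<rho>') \<leadsto> ({#}, g v \<rho>')"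
    if "v \<in> nonsinks G" "\<rho>' \<in> rotor_configs G" for v \<rho>'
    using that by (simp add: g_def fires_funpow_chip_add)
  interpret g: comp_fun_commute_on "nonsinks G" g
  proof
    fix v w assume v: "v \<in> nonsinks G" and w: "w \<in> nonsinks G"
    show "g w \<circ> g v = g v \<circ> g w"
    proof
      fix \<rho>'
      show "(g w \<circ> g v) \<rho>' = (g v \<circ> g w) \<rho>'"
      proof (cases "\<rho>' \<in> rotor_configs G")
        case True
        have "(replicate_mset (\<sigma> v) v + replicate_mset (\<sigma> w) w, \<rho>') \<leadsto> ({#}, g w (g v \<rho>'))"
          using fires_add2[OF fires_g[OF v True] fires_g[OF w g_in[OF v True]]] by simp
        moreover have "(replicate_mset (\<sigma> v) v + replicate_mset (\<sigma> w) w, \<rho>') \<leadsto> ({#}, g v (g w \<rho>'))"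
          using fires_add2[OF fires_g[OF w True] fires_g[OF v g_in[OF w True]]]
          by (simp add: add.commute)
        ultimately show ?thesis using fires_unique by simp
      qed (simp add: g_def)
    qed
  qed
  have eq: "chip_act G nxt \<sigma> \<rho> = Finite_Set.fold g \<rho> (nonsinks G)"
    unfolding chip_act_def
    by (rule fold_closed_eq[where B = "rotor_configs G"]) (use \<rho> g_in in \<open>auto simp: g_def\<close>)
  have "(\<Sum>v\<in>A. replicate_mset (\<sigma> v) v, \<rho>) \<leadsto> ({#}, Finite_Set.fold g \<rho> A)
      \<and> Finite_Set.fold g \<rho> A \<in> rotor_configs G" if "finite A" "A \<subseteq> nonsinks G" for A
    using that
  proof (induction A)
    case (insert v A)
    then have v: "v \<in> nonsinks G" by simp
    have IH: "(\<Sum>v\<in>A. replicate_mset (\<sigma> v) v, \<rho>) \<leadsto> ({#}, Finite_Set.fold g \<rho> A)"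
      "Finite_Set.fold g \<rho> A \<in> rotor_configs G" using insert by auto
    show ?case
      using fires_add2[OF IH(1) fires_g[OF v IH(2)]] g_in[OF v IH(2)] insert
      by (simp add: add.commute)
  qed (simp add: \<rho>)
  then show ?thesis unfolding eq by auto
qed

section \<open>Full rounds of a rotor\<close>

definition successors :: "'a \<Rightarrow> 'a multiset" where
  "successors v = (\<Sum>e\<in>out_arcs G v. chip (head G e))"

text \<open>In as many firings as there are outgoing edges, the rotor uses each of them once and
  comes back to its initial edge. Chips that return to \<open>v\<close> through self-loops are set
  aside and counted in the result.\<close>

lemma fires_round:
  assumes v: "v \<in> nonsinks G" and \<rho>: "\<rho> \<in> rotor_configs G"
  shows "(replicate_mset (out_degree G v) v, \<rho>) \<leadsto> (successors v, \<rho>)"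
proof -
  let ?a = "\<rho> v" and ?d = "out_degree G v"
  \<comment> \<open>The first chip leaves along \<open>nxt ?a\<close>, not \<open>?a\<close>, so the
    edges used are the iterates starting at \<open>nxt ?a\<close>, while the rotor ends at the
    \<open>k\<close>-th iterate of \<open>?a\<close>.\<close>
  have partial: "(replicate_mset k v, \<rho>) \<leadsto>
      (\<Sum>i<k. chip (head G ((nxt ^^ i) (nxt ?a))), \<rho>(v := (nxt ^^ k) ?a))" for k
  proof (induction k)
    case (Suc k)
    have "fire ({#v#}, \<rho>(v := (nxt ^^ k) ?a))
        (chip (head G ((nxt ^^ k) (nxt ?a))), \<rho>(v := (nxt ^^ Suc k) ?a))"
      using fireI[OF v, of "{#}" "\<rho>(v := (nxt ^^ k) ?a)"] by (simp add: funpow_swap1)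
    from fires_add2[OF Suc r_into_rtranclp[of fire, OF this]]
    show ?case by (simp del: fun_upd_apply)
  qed simp
  have orbit: "orbit nxt e = out_arcs G v" if "e \<in> out_arcs G v" for e
    using that orbit_cyclic_eq3[OF cyclic_nxt[OF v]] by blast
  have bij: "bij_betw (\<lambda>i. (nxt ^^ i) e) {..<funpow_dist1 nxt e e} (out_arcs G v)"
    if "e \<in> out_arcs G v" for e
    using inj_on_funpow_dist1[of e nxt e] orbit_conv_funpow_dist1[of e nxt] orbit[OF that] that
    by (simp add: bij_betw_def lessThan_atLeast0)
  then have dist: "funpow_dist1 nxt e e = ?d" if "e \<in> out_arcs G v" for e
    using bij_betw_same_card[OF bij[OF that]] by (simp add: out_degree_def)
  have a: "?a \<in> out_arcs G v" "nxt ?a \<in> out_arcs G v"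
    using rotor_in_out_arcs[OF \<rho> v] nxt_in_out_arcs[OF v] by blast+
  have "(nxt ^^ ?d) ?a = ?a"
    using funpow_dist1_prop[of ?a nxt ?a] orbit[OF a(1)] a(1) dist[OF a(1)] by metis
  moreover have "(\<Sum>i<?d. chip (head G ((nxt ^^ i) (nxt ?a)))) = successors v"
    unfolding successors_def
    using sum.reindex_bij_betw[OF bij[OF a(2)], of "\<lambda>e. chip (head G e)"] dist[OF a(2)] by metis
  ultimately show ?thesis using partial[of ?d] by simp
qed

lemma fires_repeat:
  assumes "(M, \<rho>) \<leadsto> (N, \<rho>)"
  shows "(repeat_mset k M, \<rho>) \<leadsto> (repeat_mset k N, \<rho>)"
  by (induction k) (use fires_add2[OF assms] in auto)

lemma fires_sum:
  assumes "\<And>v. v \<in> A \<Longrightarrow> (M v, \<rho>) \<leadsto> (N v, \<rho>)"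
  shows "(\<Sum>v\<in>A. M v, \<rho>) \<leadsto> (\<Sum>v\<in>A. N v, \<rho>)"
  using assms by (induction A rule: infinite_finite_induct) (auto intro: fires_add2)

text \<open>A round leaves all rotors as they were, so any number of rounds at all vertices can be
  strung together.\<close>

lemma fires_rounds:
  assumes "\<rho> \<in> rotor_configs G"
  shows "(\<Sum>v\<in>nonsinks G. repeat_mset (c v) (replicate_mset (out_degree G v) v), \<rho>) \<leadsto>
    (\<Sum>v\<in>nonsinks G. repeat_mset (c v) (successors v), \<rho>)"
  by (intro fires_sum fires_repeat fires_round assms)

section \<open>Rotor walks that miss the sink\<close>

text \<open>Spanning trees oriented towards \<open>s\<close>, that is, the acyclic rotor configurations.\<close>

definition tree_configs :: "('a \<Rightarrow> 'b) set" where
  "tree_configs = {\<rho> \<in> rotor_configs G. \<forall>u\<in>verts G. orbit_hits (\<lambda>x. head G (\<rho> x)) s u}"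

text \<open>Following rotors without meeting \<open>s\<close> stays among finitely many non-sink
  vertices, hence repeats a vertex; one turn around the repetition is a directed cycle of rotor
  edges.\<close>

lemma cycle_if_misses_sink:
  assumes \<rho>: "\<rho> \<in> rotor_configs G" and u: "u \<in> verts G"
    and miss: "\<not> orbit_hits (\<lambda>x. head G (\<rho> x)) s u"
  shows "\<exists>p. cycle p \<and> set p \<subseteq> \<rho> ` nonsinks G"
proof -
  define f where "f = (\<lambda>x. head G (\<rho> x))"
  have arc: "\<rho> x \<in> arcs G" "tail G (\<rho> x) = x" if "x \<in> nonsinks G" for x
    using rotor_in_out_arcs[OF \<rho> that] by auto
  have f_in: "f x \<in> verts G" if "x \<in> nonsinks G" for x
    using arc[OF that] by (simp add: f_def)
  have ns: "(f ^^ n) u \<noteq> s" for n using miss by (auto simp: orbit_hits_def f_def)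
  have fu: "(f ^^ n) u \<in> nonsinks G" for n
  proof (induction n)
    case (Suc n)
    then show ?case using f_in ns[of "Suc n"] by (simp add: nonsinks_eq)
  qed (use u ns[of 0] in \<open>simp add: nonsinks_eq\<close>)
  have "\<not> inj (\<lambda>n. (f ^^ n) u)"
  proof
    assume "inj (\<lambda>n. (f ^^ n) u)"
    then have "infinite (range (\<lambda>n. (f ^^ n) u))" by (rule range_inj_infinite)
    moreover have "range (\<lambda>n. (f ^^ n) u) \<subseteq> nonsinks G" using fu by blast
    ultimately show False using finite_subset[OF _ finite_nonsinks] by blast
  qed
  then obtain i j where ij: "i < j" "(f ^^ i) u = (f ^^ j) u"
    unfolding inj_def by (metis linorder_neqE_nat)
  define x where "x = (f ^^ i) u"
  have "(f ^^ (j - i)) x = (f ^^ (j - i + i)) u" by (simp only: x_def funpow_add o_apply)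
  then have "x = (f ^^ (j - i)) x" using ij by (simp add: x_def)
  moreover have "0 < j - i" using ij by simp
  ultimately have orb: "x \<in> orbit f x" unfolding orbit_altdef by blast
  \<comment> \<open>The least positive period, so that the \<open>d\<close> vertices of one turn are
    distinct.\<close>
  define d where "d = funpow_dist1 f x x"
  have d: "(f ^^ d) x = x" "0 < d" using funpow_dist1_prop[OF orb] by (simp_all add: d_def)
  have inj: "inj_on (\<lambda>n. (f ^^ n) x) {0..<d}" using inj_on_funpow_dist1[OF orb] by (simp add: d_def)
  have fx: "(f ^^ n) x \<in> nonsinks G" for n
    using fu[of "n + i"] by (simp add: x_def funpow_add)
  define p where "p k = map (\<lambda>n. \<rho> ((f ^^ n) x)) [0..<k]" for k
  have cas: "cas x (p k) ((f ^^ k) x)" for k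
  proof (induction k)
    case (Suc k)
    have "cas x (p k @ [\<rho> ((f ^^ k) x)]) ((f ^^ Suc k) x)"
      using Suc arc[OF fx[of k]] by (auto simp: cas_append_iff f_def awlast_if_cas)
    then show ?case by (simp add: p_def)
  qed (simp add: p_def)
  have p_ne: "p d \<noteq> []" using d by (simp add: p_def)
  have awalk: "awalk x (p d) x"
    using cas[of d] d fx[of 0] arc[OF fx] by (auto simp: awalk_def p_def nonsinks_eq)
  \<comment> \<open>The definition of \<open>cycle\<close> asks for distinct vertices after the
    first one. These are the vertices of one turn with \<open>x\<close> moved from the front to the
    end.\<close>
  have "tl (awalk_verts x (p d)) = map (head G) (p d)"
    using awalk_verts_conv'[OF cas[of d]] p_ne by simp
  also have "\<dots> = map (\<lambda>n. (f ^^ n) x) [1..<Suc d]"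
    unfolding p_def by (simp add: map_Suc_upt[symmetric] f_def del: upt_Suc)
  also have "[1..<Suc d] = [1..<d] @ [d]" using d by simp
  finally have tl: "tl (awalk_verts x (p d)) = map (\<lambda>n. (f ^^ n) x) [1..<d] @ [x]"
    using d by simp
  have "distinct (map (\<lambda>n. (f ^^ n) x) [0..<d])" using inj by (simp add: distinct_map)
  then have "distinct (tl (awalk_verts x (p d)))"
    unfolding tl using d(2) by (simp add: upt_conv_Cons)
  then have "cycle (p d)" unfolding cycle_def using awalk p_ne by blast
  moreover have "set (p d) \<subseteq> \<rho> ` nonsinks G" using fx by (auto simp: p_def)
  ultimately show ?thesis by blast
qed

lemma acyclic_rotor_in_tree_configs:
  "\<rho> \<in> rotor_configs G \<Longrightarrow> acyclic_rotor G \<rho> \<Longrightarrow> \<rho> \<in> tree_configs"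
  unfolding tree_configs_def acyclic_rotor_def using cycle_if_misses_sink by blast

section \<open>Running the route of a chip backwards\<close>

text \<open>
  The sink is given a rotor to \<open>v\<close>. Whether \<open>w\<close> is reached does not depend on the rotor at \<open>w\<close>
  itself, so every step preserves this invariant.
\<close>

definition tree_states :: "'a \<Rightarrow> ('a \<times> ('a \<Rightarrow> 'b)) set" where
  "tree_states v = {(w, \<rho>). w \<in> verts G \<and> \<rho> \<in> rotor_configs G \<and>
     (\<forall>u\<in>verts G. orbit_hits ((\<lambda>x. head G (\<rho> x))(s := v)) w u)}"

text \<open>Every vertex reaches \<open>s\<close> in the tree, and the added edge leads on from
  \<open>s\<close> to \<open>v\<close>.\<close>

lemma tree_states_start:
  assumes "v \<in> verts G" "\<rho> \<in> tree_configs"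
  shows "(v, \<rho>) \<in> tree_states v"
proof -
  have "orbit_hits ((\<lambda>x. head G (\<rho> x))(s := v)) v u" if "u \<in> verts G" for u
    using orbit_hits_image[OF orbit_hits_upd, of "\<lambda>x. head G (\<rho> x)" s u v] assms that
    by (simp add: tree_configs_def)
  then show ?thesis using assms by (simp add: tree_states_def tree_configs_def)
qed

lemma tree_states_end:
  assumes "(s, \<rho>) \<in> tree_states v"
  shows "\<rho> \<in> tree_configs"
proof -
  let ?f = "\<lambda>x. head G (\<rho> x)"
  \<comment> \<open>\<open>\<rho>\<close> has a default value at \<open>s\<close>, so
    \<open>?f s\<close> is arbitrary. Putting it back alters the map only at the target
    \<open>s\<close>, which therefore stays reachable.\<close>
  have "?f(s := v, s := ?f s) = ?f" by auto
  then have "orbit_hits ?f s u" if "u \<in> verts G" for u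
    using orbit_hits_upd[of "?f(s := v)" s u "?f s"] assms that by (simp add: tree_states_def)
  then show ?thesis using assms by (simp add: tree_configs_def tree_states_def)
qed

text \<open>Here \<open>f\<close> follows the rotors as they are after the step. The old position
  \<open>w\<close> is a preimage of the new one and is reached from everywhere, in particular from
  the new position; this is what determines \<open>w\<close> from the new state.\<close>

lemma tree_states_step:
  assumes "(w, \<rho>) \<in> tree_states v" "w \<noteq> s"
  defines "\<rho>' \<equiv> \<rho>(w := nxt (\<rho> w))"
  defines "f \<equiv> (\<lambda>x. head G (\<rho>' x))(s := v)"
  shows "\<forall>u\<in>verts G. orbit_hits f w u" and "f w = fst (step (w, \<rho>))"
    and "step (w, \<rho>) \<in> tree_states v"
proof -
  have f_eq: "f = ((\<lambda>x. head G (\<rho> x))(s := v))(w := head G (nxt (\<rho> w)))"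
    using assms(2) by (auto simp: f_def \<rho>'_def)
  show hits: "\<forall>u\<in>verts G. orbit_hits f w u"
    unfolding f_eq using assms(1) by (auto simp: tree_states_def intro: orbit_hits_upd)
  show fw: "f w = fst (step (w, \<rho>))" by (simp add: f_eq route_step_def)
  have st: "step (w, \<rho>) = (f w, \<rho>')" using fw by (simp add: route_step_def \<rho>'_def)
  have "\<forall>u\<in>verts G. orbit_hits f (f w) u" using hits by (simp add: orbit_hits_image)
  then show "step (w, \<rho>) \<in> tree_states v"
    using assms(1,2) step_in[of "(w, \<rho>)"] unfolding st
    by (simp add: tree_states_def nonsinks_eq f_def)
qed

text \<open>The new state determines the old position, as the only preimage of the new position on
  its rotor cycle. All rotors elsewhere are unchanged, and the one at the old position is recovered
  by injectivity of \<open>nxt\<close>.\<close>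

lemma step_inj:
  assumes x: "x \<in> tree_states v" "fst x \<noteq> s" and y: "y \<in> tree_states v" "fst y \<noteq> s"
    and eq: "step x = step y"
  shows "x = y"
proof -
  obtain w \<rho> w' \<rho>' where xy: "x = (w, \<rho>)" "y = (w', \<rho>')" by fastforce
  define \<theta> where "\<theta> = \<rho>(w := nxt (\<rho> w))"
  have \<theta>: "\<theta> = \<rho>'(w' := nxt (\<rho>' w'))" using eq by (simp add: xy \<theta>_def route_step_def)
  define f where "f = (\<lambda>z. head G (\<theta> z))(s := v)"
  define q where "q = fst (step x)"
  have q: "q \<in> verts G" using tree_states_step(3)[of w \<rho> v] x
    by (auto simp: q_def xy tree_states_def)
  have "orbit_hits f w q" "f w = q"
    using tree_states_step(1,2)[of w \<rho> v] x q by (simp_all add: xy f_def \<theta>_def q_def)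
  moreover have "orbit_hits f w' q" "f w' = q"
    using tree_states_step(1,2)[of w' \<rho>' v] y q eq
    by (simp_all add: xy f_def \<theta> q_def)
  ultimately have w: "w = w'" by (rule unique_periodic_preimage)
  have wn: "w \<in> nonsinks G" and in_rc: "\<rho> \<in> rotor_configs G" "\<rho>' \<in> rotor_configs G"
    using x y by (auto simp: xy tree_states_def nonsinks_eq)
  have "nxt (\<rho> w) = nxt (\<rho>' w)" using \<theta> w unfolding \<theta>_def by (metis fun_upd_same)
  then have "\<rho> w = \<rho>' w"
    using inj_onD[OF inj_on_nxt[OF wn]] rotor_in_out_arcs[OF _ wn] in_rc by blast
  moreover have "\<rho> z = \<rho>' z" if "z \<noteq> w" for z
    using \<theta> w that unfolding \<theta>_def by (metis fun_upd_other)
  ultimately have "\<rho> = \<rho>'" by (metis ext)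
  then show ?thesis by (simp add: xy w)
qed

text \<open>In the starting state the predecessor of \<open>v\<close> on the rotor cycle is
  \<open>s\<close>, through the added edge. A step into that state would thus have to start with the
  chip at \<open>s\<close>.\<close>

lemma step_not_start:
  assumes x: "x \<in> tree_states v" "fst x \<noteq> s" and v: "v \<in> verts G" and \<rho>: "\<rho> \<in> tree_configs"
  shows "step x \<noteq> (v, \<rho>)"
proof
  assume eq: "step x = (v, \<rho>)"
  obtain w \<rho>0 where xy: "x = (w, \<rho>0)" by fastforce
  define f where "f = (\<lambda>z. head G (\<rho> z))(s := v)"
  have "\<rho> = \<rho>0(w := nxt (\<rho>0 w))" using eq by (simp add: xy route_step_def)
  then have "orbit_hits f w v" "f w = v"
    using tree_states_step(1,2)[of w \<rho>0 v] x v eq by (simp_all add: xy f_def)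
  moreover have "orbit_hits f s v" "f s = v"
    using \<rho> v by (auto simp: tree_configs_def f_def intro: orbit_hits_upd)
  ultimately have "w = s" by (rule unique_periodic_preimage)
  then show False using x by (simp add: xy)
qed

lemma route_tree_states:
  assumes v: "v \<in> nonsinks G" and \<rho>: "\<rho> \<in> tree_configs"
    and "\<And>k. k < n \<Longrightarrow> fst ((step ^^ k) (v, \<rho>)) \<in> nonsinks G"
  shows "(step ^^ n) (v, \<rho>) \<in> tree_states v"
  using assms(3)
proof (induction n)
  case 0
  show ?case using tree_states_start[OF _ \<rho>] v by (simp add: nonsinks_eq)
next
  case (Suc n)
  then show ?case
    using tree_states_step(3)[of "fst ((step ^^ n) (v, \<rho>))" "snd ((step ^^ n) (v, \<rho>))" v]
    by (simp add: nonsinks_eq)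
qed

lemma chip_add_tree_configs:
  assumes "v \<in> nonsinks G" "\<rho> \<in> tree_configs"
  shows "chip_add G nxt v \<rho> \<in> tree_configs"
proof -
  have "\<rho> \<in> rotor_configs G" using assms by (simp add: tree_configs_def)
  from chip_add_route[OF assms(1) this] obtain n
    where n: "(step ^^ n) (v, \<rho>) = (s, chip_add G nxt v \<rho>)"
      and "\<And>k. k < n \<Longrightarrow> fst ((step ^^ k) (v, \<rho>)) \<in> nonsinks G"
    by metis
  then have "(step ^^ n) (v, \<rho>) \<in> tree_states v" using route_tree_states[OF assms] by blast
  then show ?thesis unfolding n by (rule tree_states_end)
qed

text \<open>Two routes with a common end are run backwards by \<open>step_inj\<close> until the
  shorter one is at its start. A surplus \<open>m > 0\<close> would then give a step into a starting
  state, which \<open>step_not_start\<close> excludes.\<close>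

lemma routes_start_equal:
  assumes v: "v \<in> nonsinks G" and \<rho>: "\<rho> \<in> tree_configs" "\<rho>' \<in> tree_configs"
    and "\<And>k. k < n \<Longrightarrow> fst ((step ^^ k) (v, \<rho>)) \<in> nonsinks G"
    and "\<And>k. k < n + m \<Longrightarrow> fst ((step ^^ k) (v, \<rho>')) \<in> nonsinks G"
    and "(step ^^ n) (v, \<rho>) = (step ^^ (n + m)) (v, \<rho>')"
  shows "\<rho> = \<rho>'"
  using assms(4-)
proof (induction n)
  case 0
  show ?case
  proof (cases m)
    case (Suc k)
    then have "step ((step ^^ k) (v, \<rho>')) = (v, \<rho>)" using 0 by simp
    moreover have "(step ^^ k) (v, \<rho>') \<in> tree_states v"
      using 0 Suc by (intro route_tree_states v \<rho>) simp
    moreover have "fst ((step ^^ k) (v, \<rho>')) \<noteq> s" using 0(2)[of k] Suc by (simp add: nonsinks_eq)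
    ultimately show ?thesis using step_not_start v \<rho> by (simp add: nonsinks_eq)
  qed (use 0 in simp)
next
  case (Suc n)
  have "(step ^^ n) (v, \<rho>) = (step ^^ (n + m)) (v, \<rho>')"
  proof (rule step_inj)
    show "(step ^^ n) (v, \<rho>) \<in> tree_states v" "(step ^^ (n + m)) (v, \<rho>') \<in> tree_states v"
      using Suc.prems by (auto intro!: route_tree_states v \<rho>)
    show "fst ((step ^^ n) (v, \<rho>)) \<noteq> s" "fst ((step ^^ (n + m)) (v, \<rho>')) \<noteq> s"
      using Suc.prems(1)[of n] Suc.prems(2)[of "n + m"] by (auto simp: nonsinks_eq)
    show "step ((step ^^ n) (v, \<rho>)) = step ((step ^^ (n + m)) (v, \<rho>'))"
      using Suc.prems(3) by simp
  qed
  then show ?case using Suc by simp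
qed

lemma chip_add_inj:
  assumes v: "v \<in> nonsinks G" and \<rho>: "\<rho> \<in> tree_configs" "\<rho>' \<in> tree_configs"
    and eq: "chip_add G nxt v \<rho> = chip_add G nxt v \<rho>'"
  shows "\<rho> = \<rho>'"
proof -
  have rc: "\<rho> \<in> rotor_configs G" "\<rho>' \<in> rotor_configs G" using \<rho> by (auto simp: tree_configs_def)
  obtain n where n: "(step ^^ n) (v, \<rho>) = (s, chip_add G nxt v \<rho>)"
    "\<And>k. k < n \<Longrightarrow> fst ((step ^^ k) (v, \<rho>)) \<in> nonsinks G"
    using chip_add_route[OF v rc(1)] by metis
  obtain n' where n': "(step ^^ n') (v, \<rho>') = (s, chip_add G nxt v \<rho>')"
    "\<And>k. k < n' \<Longrightarrow> fst ((step ^^ k) (v, \<rho>')) \<in> nonsinks G"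
    using chip_add_route[OF v rc(2)] by metis
  show ?thesis
  proof (cases "n \<le> n'")
    case True
    then show ?thesis
      using routes_start_equal[OF v \<rho>, of n "n' - n"] n n' eq by simp
  next
    case False
    then have nn: "n' + (n - n') = n" by simp
    have "\<rho>' = \<rho>"
    proof (rule routes_start_equal[OF v \<rho>(2,1)])
      show "(step ^^ n') (v, \<rho>') = (step ^^ (n' + (n - n'))) (v, \<rho>)"
        unfolding nn n n' eq ..
    qed (use n(2) n'(2) nn in auto)
    then show ?thesis ..
  qed
qed

section \<open>Cancelling chips\<close>

text \<open>By confluence a chosen chip may be routed to the sink first, so the chips can be
  cancelled one by one with \<open>chip_add_inj\<close>.\<close>

lemma fires_inj:
  assumes "set_mset M \<subseteq> nonsinks G" "\<rho> \<in> tree_configs" "\<rho>' \<in> tree_configs"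
    and "(M, \<rho>) \<leadsto> ({#}, \<theta>)" "(M, \<rho>') \<leadsto> ({#}, \<theta>)"
  shows "\<rho> = \<rho>'"
  using assms
proof (induction M arbitrary: \<rho> \<rho>')
  case empty
  then show ?case using fires_final by blast
next
  case (add v M)
  have v: "v \<in> nonsinks G" using add.prems by simp
  have tail: "(M, chip_add G nxt v \<eta>) \<leadsto> ({#}, \<theta>)"
    if "\<eta> \<in> tree_configs" "(add_mset v M, \<eta>) \<leadsto> ({#}, \<theta>)" for \<eta>
  proof (rule fires_confluent[OF _ that(2)])
    have "\<eta> \<in> rotor_configs G" using that by (simp add: tree_configs_def)
    from fires_add[OF fires_chip_add[OF v this], of M]
    show "(add_mset v M, \<eta>) \<leadsto> (M, chip_add G nxt v \<eta>)" by simp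
  qed
  have "chip_add G nxt v \<rho> = chip_add G nxt v \<rho>'"
    using add.prems by (intro add.IH tail chip_add_tree_configs v) auto
  then show ?case using chip_add_inj[OF v] add.prems by blast
qed

lemma fires_terminates:
  assumes "set_mset M \<subseteq> nonsinks G" "\<rho> \<in> tree_configs"
  shows "\<exists>\<theta>\<in>tree_configs. (M, \<rho>) \<leadsto> ({#}, \<theta>)"
  using assms
proof (induction M arbitrary: \<rho>)
  case (add v M)
  then have v: "v \<in> nonsinks G" by simp
  obtain \<theta> where \<theta>: "\<theta> \<in> tree_configs" "(M, chip_add G nxt v \<rho>) \<leadsto> ({#}, \<theta>)"
    using add.IH[of "chip_add G nxt v \<rho>"] add.prems chip_add_tree_configs[OF v] by auto
  have "({#v#}, \<rho>) \<leadsto> ({#}, chip_add G nxt v \<rho>)"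
    using fires_chip_add[OF v] add.prems by (simp add: tree_configs_def)
  from fires_add2[OF this \<theta>(2)] \<theta>(1) show ?case by auto
qed blast

section \<open>Chip counts and the reduced Laplacian\<close>

lemma count_successors:
  "w \<in> nonsinks G \<Longrightarrow> count (successors v) w = edge_count G v w"
proof -
  assume w: "w \<in> nonsinks G"
  have "count (successors v) w = (\<Sum>e\<in>out_arcs G v. if head G e = w then 1 else 0)"
    unfolding successors_def count_sum by (rule sum.cong) (use w in \<open>auto simp: chip_def\<close>)
  also have "\<dots> = card {e \<in> out_arcs G v. head G e = w}"
    by (subst sum.inter_filter[symmetric]) auto
  finally show ?thesis by (simp only: edge_count_def)
qed

lemma set_successors: "set_mset (successors v) \<subseteq> nonsinks G"
  by (auto simp: successors_def chip_def set_mset_sum[OF finite_out_arcs] split: if_splits)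

lemma chip_act_eq_if_laplacian_equiv:
  assumes \<rho>: "\<rho> \<in> tree_configs"
    and equiv: "laplacian_equiv G (\<lambda>v. int (\<sigma>\<^sub>1 v)) (\<lambda>v. int (\<sigma>\<^sub>2 v))"
  shows "chip_act G nxt \<sigma>\<^sub>1 \<rho> = chip_act G nxt \<sigma>\<^sub>2 \<rho>"
proof -
  let ?N = "nonsinks G"
  obtain c where c: "\<And>w. w \<in> ?N \<Longrightarrow>
      int (\<sigma>\<^sub>1 w) - int (\<sigma>\<^sub>2 w) = (\<Sum>v\<in>?N. c v * reduced_laplacian G v w)"
    using equiv unfolding laplacian_equiv_def by blast
  define cp cm where "cp v = nat (c v)" and "cm v = nat (- c v)" for v
  \<comment> \<open>\<open>D k\<close> holds the chips used by \<open>k v\<close> rounds at each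
    \<open>v\<close>, and \<open>S k\<close> is what they become. As integer vectors,
    \<open>D k - S k\<close> is the row combination of \<Delta>' with coefficients
    \<open>k\<close>.\<close>
  define D S where "D k = (\<Sum>v\<in>?N. repeat_mset (k v) (replicate_mset (out_degree G v) v))"
    and "S k = (\<Sum>v\<in>?N. repeat_mset (k v) (successors v))" for k
  define M where "M \<sigma> = (\<Sum>v\<in>?N. replicate_mset (\<sigma> v) v)" for \<sigma>
  have rc: "\<rho> \<in> rotor_configs G" using \<rho> by (simp add: tree_configs_def)
  have round: "(D k, \<rho>) \<leadsto> (S k, \<rho>)" for k unfolding D_def S_def by (rule fires_rounds[OF rc])
  have set_S: "set_mset (S k) \<subseteq> ?N" for k
  proof
    fix w assume "w \<in># S k"
    then obtain v where "w \<in># repeat_mset (k v) (successors v)"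
      by (auto simp: S_def set_mset_sum)
    then have "w \<in># successors v" by (simp flip: count_greater_zero_iff)
    then show "w \<in> ?N" using set_successors by blast
  qed
  have count_M: "count (M \<sigma>) w = (if w \<in> ?N then \<sigma> w else 0)" for \<sigma> w
    unfolding M_def count_sum by simp
  have count_D: "count (D k) w = (if w \<in> ?N then k w * out_degree G w else 0)" for k w
  proof -
    have "count (D k) w = (\<Sum>v\<in>?N. if w = v then k v * out_degree G v else 0)"
      unfolding D_def count_sum by (rule sum.cong) auto
    then show ?thesis by simp
  qed
  have count_S: "count (S k) w = (if w \<in> ?N then \<Sum>v\<in>?N. k v * edge_count G v w else 0)" for k w
  proof (cases "w \<in> ?N")
    case True
    then show ?thesis by (simp add: S_def count_sum count_successors)
  next
    case False
    then have "w \<notin># S k" using set_S by blast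
    then show ?thesis using False by (simp add: count_eq_zero_iff)
  qed
  \<comment> \<open>The equation \<open>\<sigma>\<^sub>1 - \<sigma>\<^sub>2 = (D cp - S cp) - (D cm
    - S cm)\<close>, rearranged so that multisets are only added.\<close>
  have eq: "M \<sigma>\<^sub>1 + D cm + S cp = M \<sigma>\<^sub>2 + D cp + S cm"
  proof (rule multiset_eqI)
    fix w
    show "count (M \<sigma>\<^sub>1 + D cm + S cp) w = count (M \<sigma>\<^sub>2 + D cp + S cm) w"
    proof (cases "w \<in> ?N")
      case True
      \<comment> \<open>Only the out-degree is split off from the diagonal entry; self-loops then
        join the other edges in one sum.\<close>
      have "(\<Sum>v\<in>?N. c v * reduced_laplacian G v w) =
          (\<Sum>v\<in>?N. (if v = w then c w * int (out_degree G w) else 0) - c v * int (edge_count G v w))"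
        by (rule sum.cong) (auto simp: reduced_laplacian_def algebra_simps)
      also have "\<dots> = c w * int (out_degree G w) - (\<Sum>v\<in>?N. c v * int (edge_count G v w))"
        using True by (simp add: sum_subtractf)
      also have "(\<Sum>v\<in>?N. c v * int (edge_count G v w)) =
          (\<Sum>v\<in>?N. int (cp v) * int (edge_count G v w)) - (\<Sum>v\<in>?N. int (cm v) * int (edge_count G v w))"
        unfolding sum_subtractf[symmetric]
        by (rule sum.cong) (auto simp: cp_def cm_def)
      also have "c w * int (out_degree G w) =
          int (cp w) * int (out_degree G w) - int (cm w) * int (out_degree G w)"
        by (auto simp: cp_def cm_def)
      finally have "int (\<sigma>\<^sub>1 w + cm w * out_degree G w + (\<Sum>v\<in>?N. cp v * edge_count G v w)) =
          int (\<sigma>\<^sub>2 w + cp w * out_degree G w + (\<Sum>v\<in>?N. cm v * edge_count G v w))"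
        using c[OF True] by simp
      then show ?thesis using True by (simp only: count_M count_D count_S of_nat_eq_iff count_union if_True)
    qed (simp add: count_M count_D count_S)
  qed
  let ?\<rho>1 = "chip_act G nxt \<sigma>\<^sub>1 \<rho>" and ?\<rho>2 = "chip_act G nxt \<sigma>\<^sub>2 \<rho>"
  have act: "(M \<sigma>, \<rho>) \<leadsto> ({#}, chip_act G nxt \<sigma> \<rho>)" for \<sigma>
    unfolding M_def by (rule fires_chip_act[OF rc])
  \<comment> \<open>Rounds turn \<open>D k\<close> into \<open>S k\<close> at unchanged rotors, and
    then the chips of \<open>\<sigma>\<close> are routed away. The two choices
    \<open>(cm, cp)\<close> and \<open>(cp, cm)\<close> for \<open>(k, l)\<close> leave the same
    chips, which are the \<tau> to be cancelled.\<close>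
  have fires_S: "(M \<sigma> + D k + S l, \<rho>) \<leadsto> (S k + S l, chip_act G nxt \<sigma> \<rho>)" for \<sigma> k l
  proof -
    have "(M \<sigma> + D k + S l, \<rho>) \<leadsto> (M \<sigma> + (S k + S l), \<rho>)"
      using fires_add[OF round[of k], of "M \<sigma> + S l"] by (simp only: ac_simps)
    also have "\<dots> \<leadsto> (S k + S l, chip_act G nxt \<sigma> \<rho>)"
      using fires_add[OF act[of \<sigma>], of "S k + S l"] by simp
    finally show ?thesis .
  qed
  have tree: "chip_act G nxt \<sigma> \<rho> \<in> tree_configs" for \<sigma>
  proof -
    have "set_mset (M \<sigma>) \<subseteq> ?N"
      by (auto simp: M_def set_mset_sum split: if_splits)
    then show ?thesis using fires_terminates[OF _ \<rho>] fires_unique[OF act[of \<sigma>]] by blast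
  qed
  have set_SS: "set_mset (S cm + S cp) \<subseteq> ?N" using set_S by simp
  then obtain \<theta> where \<theta>: "(S cm + S cp, ?\<rho>1) \<leadsto> ({#}, \<theta>)"
    using fires_terminates tree by blast
  \<comment> \<open>By \<open>eq\<close> both computations start from one state, so the end
    \<open>\<theta>\<close> of the first is also reached from the second.\<close>
  have "(M \<sigma>\<^sub>1 + D cm + S cp, \<rho>) \<leadsto> (S cm + S cp, ?\<rho>2)"
    unfolding eq using fires_S[of \<sigma>\<^sub>2 cp cm] by (simp only: add.commute[of "S cm"])
  then have "(S cm + S cp, ?\<rho>2) \<leadsto> ({#}, \<theta>)"
    using fires_confluent rtranclp_trans[OF fires_S \<theta>] by blast
  with \<theta> show ?thesis
    using fires_inj[OF set_SS tree tree] by blast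
qed

end

theorem lemma3p12:
  fixes G :: "('a, 'b) pre_digraph" and s :: 'a and nxt :: "'b \<Rightarrow> 'b"
    and \<rho> :: "'a \<Rightarrow> 'b" and \<sigma>\<^sub>1 \<sigma>\<^sub>2 :: "'a \<Rightarrow> nat"
  assumes "fin_digraph G"
    and "global_sink G s"
    and "rotor_order G nxt"
    and "\<rho> \<in> rotor_configs G"
    and "acyclic_rotor G \<rho>"
    and "laplacian_equiv G (\<lambda>v. int (\<sigma>\<^sub>1 v)) (\<lambda>v. int (\<sigma>\<^sub>2 v))"
  shows "chip_act G nxt \<sigma>\<^sub>1 \<rho> = chip_act G nxt \<sigma>\<^sub>2 \<rho>"
proof -
  interpret fin_digraph G by fact
  interpret rotor_router G s nxt by unfold_locales fact+
  show ?thesis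
    using assms by (intro chip_act_eq_if_laplacian_equiv acyclic_rotor_in_tree_configs)
qed

end
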